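(* Let $\Lambda$ be a row-finite $k$-graph with no sources. Suppose $(T,\sigma)$ is a $\Lambda$-system of maps, $\Phi:\Lambda^\infty\to T$ is an intertwining map with respect to $(T,\sigma)$, and $T'$ is the attractor of $(T,\sigma,\Phi)$. Then there exist a $1$-graph $E$ (row-finite with no sources) with $E^0=\Lambda^0$, an $E$-system of maps $(T,\rho)$ (on the same bundle of spaces $T$), and an intertwining map $\Psi:E^\infty\to T$ with respect to $(T,\rho)$ such that if $T''$ is the attractor of $(T,\rho,\Psi)$ then $T''=T'$.
   Context: A $k$-graph is a countable small category $\Lambda$ with a degree functor $d:\Lambda\to\mathbb{N}^k$ having the unique factorization property: if $d(\lambda)=m+n$ then $\lambda=\mu\nu$ for unique $\mu,\nu$ with $d(\mu)=m$, $d(\nu)=n$. Put $\Lambda^n=d^{-1}(n)$; $\Lambda^0$ is identified with the objects (vertices); $\lambda\mu$ is defined when $s(\lambda)=r(\mu)$. Write $u\Lambda v=\{\lambda: r(\lambda)=u,s(\lambda)=v\}$, $v\Lambda^n=\{\lambda\in\Lambda^n:r(\lambda)=v\}$. Row-finite with no sources: $v\Lambda^n$ is finite and nonempty for all $v\in\Lambda^0$, $n\in\mathbb{N}^k$. A $1$-graph is the path category of a directed graph. $\Omega_k$ is the $k$-graph $\{(m,n)\in\mathbb{N}^k\times\mathbb{N}^k:m\le n\}$ with $r(m,n)=m$, $s(m,n)=n$, $d(m,n)=n-m$. $\Lambda^\infty$ is the set of degree-preserving functors $x:\Omega_k\to\Lambda$, with $r(x)=x(0,0)$, $v\Lambda^\infty=\{x:r(x)=v\}$,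 and topology generated by the sets $\{\lambda x: x\in s(\lambda)\Lambda^\infty\}$, $\lambda\in\Lambda$. For $\lambda\in u\Lambda v$, $\tau_\lambda:v\Lambda^\infty\to u\Lambda^\infty$ is $\tau_\lambda(x)=\lambda x$. A $\Lambda$-system of maps $(T,\sigma)$ consists of locally compact Hausdorff spaces $T_v$ ($v\in\Lambda^0$), $T=\bigsqcup_{v}T_v$ (topological disjoint union), and continuous maps $\sigma_\lambda:T_v\to T_u$ for $\lambda\in u\Lambda v$, with $\sigma_\lambda\circ\sigma_\mu=\sigma_{\lambda\mu}$ if $s(\lambda)=r(\mu)$ and $\sigma_v=\mathrm{id}_{T_v}$ for $v\in\Lambda^0$. A continuous map $\Phi:\Lambda^\infty\to T$ is intertwining (with respect to $(T,\sigma)$) if $\Phi\circ\tau_\lambda=\sigma_\lambda\circ\Phi$ on $s(\lambda)\Lambda^\infty$ for all $\lambda\in\Lambda$ (in particular $\Phi(v\Lambda^\infty)\subset T_v$). The attractor of $(T,\sigma,\Phi)$ is $T'=\bigcup_{v\in\Lambda^0}T'_v$, where $T'_v=\Phi(v\Lambda^\infty)$. The same definitions apply to $E$ (the case $k=1$). *)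

theory Defs
  imports "HOL-Analysis.Analysis"
begin

text \<open>A category on sets of objects and morphisms, with a degree map into $\mathbb{N}^k$; the rank
  \<open>k\<close> is the cardinality of the finite index type \<open>'k\<close>, and a 1-graph has the index type \<open>1\<close>.
  Following the range/source convention for \<open>k\<close>-graphs, \<open>Comp G \<alpha> \<mu>\<close> is $\alpha\mu$, meaningful only if
  \<open>src G \<alpha> = rng G \<mu>\<close>.\<close>

record ('v, 'm, 'k) kgraph =
  Obj :: "'v set"
  Mor :: "'m set"
  rng :: "'m \<Rightarrow> 'v"
  src :: "'m \<Rightarrow> 'v"
  Ident :: "'v \<Rightarrow> 'm"
  Comp :: "'m \<Rightarrow> 'm \<Rightarrow> 'm"
  deg :: "'m \<Rightarrow> nat ^ 'k"

locale small_category =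
  fixes G :: "('v, 'm, 'k::finite) kgraph"
  assumes rng_in: "\<alpha> \<in> Mor G \<Longrightarrow> rng G \<alpha> \<in> Obj G"
    and src_in: "\<alpha> \<in> Mor G \<Longrightarrow> src G \<alpha> \<in> Obj G"
    and Id_in: "v \<in> Obj G \<Longrightarrow> Ident G v \<in> Mor G"
    and rng_Id: "v \<in> Obj G \<Longrightarrow> rng G (Ident G v) = v"
    and src_Id: "v \<in> Obj G \<Longrightarrow> src G (Ident G v) = v"
    and comp_in: "\<lbrakk>\<alpha> \<in> Mor G; \<mu> \<in> Mor G; src G \<alpha> = rng G \<mu>\<rbrakk> \<Longrightarrow> Comp G \<alpha> \<mu> \<in> Mor G"
    and rng_comp: "\<lbrakk>\<alpha> \<in> Mor G; \<mu> \<in> Mor G; src G \<alpha> = rng G \<mu>\<rbrakk> \<Longrightarrow> rng G (Comp G \<alpha> \<mu>) = rng G \<alpha>"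
    and src_comp: "\<lbrakk>\<alpha> \<in> Mor G; \<mu> \<in> Mor G; src G \<alpha> = rng G \<mu>\<rbrakk> \<Longrightarrow> src G (Comp G \<alpha> \<mu>) = src G \<mu>"
    and comp_assoc: "\<lbrakk>\<alpha> \<in> Mor G; \<mu> \<in> Mor G; \<nu> \<in> Mor G; src G \<alpha> = rng G \<mu>; src G \<mu> = rng G \<nu>\<rbrakk>
      \<Longrightarrow> Comp G (Comp G \<alpha> \<mu>) \<nu> = Comp G \<alpha> (Comp G \<mu> \<nu>)"
    and Id_comp: "\<alpha> \<in> Mor G \<Longrightarrow> Comp G (Ident G (rng G \<alpha>)) \<alpha> = \<alpha>"
    and comp_Id: "\<alpha> \<in> Mor G \<Longrightarrow> Comp G \<alpha> (Ident G (src G \<alpha>)) = \<alpha>"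

locale k_graph = small_category G for G :: "('v, 'm, 'k::finite) kgraph" +
  assumes countable_Obj: "countable (Obj G)"
    and countable_Mor: "countable (Mor G)"
    and deg_Id: "v \<in> Obj G \<Longrightarrow> deg G (Ident G v) = 0"
    and deg_comp: "\<lbrakk>\<alpha> \<in> Mor G; \<mu> \<in> Mor G; src G \<alpha> = rng G \<mu>\<rbrakk>
      \<Longrightarrow> deg G (Comp G \<alpha> \<mu>) = deg G \<alpha> + deg G \<mu>"
    and unique_factorization: "\<lbrakk>\<alpha> \<in> Mor G; deg G \<alpha> = m + n\<rbrakk>
      \<Longrightarrow> \<exists>!(\<mu>, \<nu>). \<mu> \<in> Mor G \<and> \<nu> \<in> Mor G \<and> src G \<mu> = rng G \<nu>
            \<and> deg G \<mu> = m \<and> deg G \<nu> = n \<and> \<alpha> = Comp G \<mu> \<nu>"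

definition row_finite_no_sources :: "('v, 'm, 'k::finite) kgraph \<Rightarrow> bool" where
  "row_finite_no_sources G \<longleftrightarrow>
     (\<forall>v \<in> Obj G. \<forall>n. finite {\<alpha> \<in> Mor G. rng G \<alpha> = v \<and> deg G \<alpha> = n}
                    \<and> {\<alpha> \<in> Mor G. rng G \<alpha> = v \<and> deg G \<alpha> = n} \<noteq> {})"

definition Omega :: "(nat ^ 'k, (nat ^ 'k) \<times> (nat ^ 'k), 'k::finite) kgraph" where
  "Omega = \<lparr>Obj = UNIV, Mor = {(m, n). m \<le> n}, rng = fst, src = snd, Ident = (\<lambda>m. (m, m)),
            Comp = (\<lambda>p q. (fst p, snd q)), deg = (\<lambda>p. snd p - fst p)\<rparr>"

text \<open>Degree-preserving functors, as pairs (object map, morphism map). Both maps are extensional,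
  so that equality of pairs is equality of functors.\<close>

definition degree_functors ::
  "('a, 'b, 'k::finite) kgraph \<Rightarrow> ('v, 'm, 'k) kgraph \<Rightarrow> (('a \<Rightarrow> 'v) \<times> ('b \<Rightarrow> 'm)) set" where
  "degree_functors C D =
     {(F0, F1). F0 \<in> Obj C \<rightarrow>\<^sub>E Obj D \<and> F1 \<in> Mor C \<rightarrow>\<^sub>E Mor D
        \<and> (\<forall>f \<in> Mor C. rng D (F1 f) = F0 (rng C f) \<and> src D (F1 f) = F0 (src C f))
        \<and> (\<forall>a \<in> Obj C. F1 (Ident C a) = Ident D (F0 a))
        \<and> (\<forall>f \<in> Mor C. \<forall>g \<in> Mor C. src C f = rng C g \<longrightarrow> F1 (Comp C f g) = Comp D (F1 f) (F1 g))
        \<and> (\<forall>f \<in> Mor C. deg D (F1 f) = deg C f)}"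

type_synonym ('v, 'm, 'k) path = "(nat ^ 'k \<Rightarrow> 'v) \<times> ((nat ^ 'k) \<times> (nat ^ 'k) \<Rightarrow> 'm)"

definition inf_paths :: "('v, 'm, 'k::finite) kgraph \<Rightarrow> ('v, 'm, 'k) path set" where
  "inf_paths G = degree_functors Omega G"

text \<open>The vertex $r(x) = x(0,0)$ is the value of the object map at 0.\<close>

definition path_range :: "('v, 'm, 'k::finite) path \<Rightarrow> 'v" where
  "path_range x = fst x 0"

definition inf_paths_at :: "('v, 'm, 'k::finite) kgraph \<Rightarrow> 'v \<Rightarrow> ('v, 'm, 'k) path set" where
  "inf_paths_at G v = {x \<in> inf_paths G. path_range x = v}"

text \<open>For \<open>\<alpha> \<in> Mor G\<close> and \<open>x \<in> inf_paths_at G (src G \<alpha>)\<close>, \<open>prefix_path G \<alpha> x\<close> is the path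
  $\alpha x$: the unique infinite path \<open>y\<close> with $y(0,d(\alpha)) = \alpha$ whose shift by $d(\alpha)$
  is \<open>x\<close> (Kumjian and Pask).\<close>

definition prefix_path ::
  "('v, 'm, 'k::finite) kgraph \<Rightarrow> 'm \<Rightarrow> ('v, 'm, 'k) path \<Rightarrow> ('v, 'm, 'k) path" where
  "prefix_path G \<alpha> x =
     (THE y. y \<in> inf_paths G \<and> snd y (0, deg G \<alpha>) = \<alpha>
        \<and> (\<forall>m n. m \<le> n \<longrightarrow> snd y (m + deg G \<alpha>, n + deg G \<alpha>) = snd x (m, n)))"

text \<open>The cylinder sets of the identities cover \<open>inf_paths G\<close>, so that is the underlying set
  of this topology.\<close>

definition path_topology :: "('v, 'm, 'k::finite) kgraph \<Rightarrow> ('v, 'm, 'k) path topology" where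
  "path_topology G =
     topology_generated_by ((\<lambda>\<alpha>. prefix_path G \<alpha> ` inf_paths_at G (src G \<alpha>)) ` Mor G)"

text \<open>A system on the spaces \<open>T v\<close>. The maps \<open>\<sigma> \<alpha>\<close> act on the fibres and are relevant only on
  \<open>topspace (T (src G \<alpha>))\<close>; a vertex \<open>v\<close> is identified with the morphism \<open>Ident G v\<close>.\<close>

definition system_of_maps ::
  "('v, 'm, 'k::finite) kgraph \<Rightarrow> ('v \<Rightarrow> 't topology) \<Rightarrow> ('m \<Rightarrow> 't \<Rightarrow> 't) \<Rightarrow> bool" where
  "system_of_maps G T \<sigma> \<longleftrightarrow>
     (\<forall>v \<in> Obj G. locally_compact_space (T v) \<and> Hausdorff_space (T v))
   \<and> (\<forall>\<alpha> \<in> Mor G. continuous_map (T (src G \<alpha>)) (T (rng G \<alpha>)) (\<sigma> \<alpha>))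
   \<and> (\<forall>\<alpha> \<in> Mor G. \<forall>\<mu> \<in> Mor G. src G \<alpha> = rng G \<mu> \<longrightarrow>
        (\<forall>t \<in> topspace (T (src G \<mu>)). \<sigma> \<alpha> (\<sigma> \<mu> t) = \<sigma> (Comp G \<alpha> \<mu>) t))
   \<and> (\<forall>v \<in> Obj G. \<forall>t \<in> topspace (T v). \<sigma> (Ident G v) t = t)"

text \<open>The total space is the topological disjoint union \<open>sum_topology T (Obj G)\<close>, whose points
  are the pairs \<open>(v, t)\<close> with \<open>t\<close> in the fibre over \<open>v\<close>; on it, \<open>\<sigma> \<alpha>\<close> sends
  \<open>(src G \<alpha>, t)\<close> to \<open>(rng G \<alpha>, \<sigma> \<alpha> t)\<close>.\<close>

definition intertwining ::
  "('v, 'm, 'k::finite) kgraph \<Rightarrow> ('v \<Rightarrow> 't topology) \<Rightarrow> ('m \<Rightarrow> 't \<Rightarrow> 't)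
     \<Rightarrow> (('v, 'm, 'k) path \<Rightarrow> 'v \<times> 't) \<Rightarrow> bool" where
  "intertwining G T \<sigma> \<Phi> \<longleftrightarrow>
     continuous_map (path_topology G) (sum_topology T (Obj G)) \<Phi>
   \<and> (\<forall>v \<in> Obj G. \<Phi> ` inf_paths_at G v \<subseteq> {v} \<times> topspace (T v))
   \<and> (\<forall>\<alpha> \<in> Mor G. \<forall>x \<in> inf_paths_at G (src G \<alpha>).
        \<Phi> (prefix_path G \<alpha> x) = (rng G \<alpha>, \<sigma> \<alpha> (snd (\<Phi> x))))"

definition attractor ::
  "('v, 'm, 'k::finite) kgraph \<Rightarrow> (('v, 'm, 'k) path \<Rightarrow> 'v \<times> 't) \<Rightarrow> ('v \<times> 't) set" where
  "attractor G \<Phi> = (\<Union>v \<in> Obj G. \<Phi> ` inf_paths_at G v)"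

end

theory Submission
  imports Defs
begin

text \<open>
  Let \<open>E\<close> have the vertices of \<open>\<Lambda>\<close> and, as its paths of length \<open>a\<close>, the morphisms of \<open>\<Lambda>\<close> of degree
  \<open>(a, \<dots>, a)\<close>, with the composition of \<open>\<Lambda>\<close>. Factorizations in \<open>E\<close> are factorizations in \<open>\<Lambda>\<close>
  along the diagonal of $\mathbb{N}^k$, so \<open>E\<close> is a 1-graph; its rows are rows of \<open>\<Lambda>\<close>, and the maps \<open>\<sigma> \<alpha>\<close> with
  \<open>\<alpha>\<close> in \<open>E\<close> form an \<open>E\<close>-system on the same spaces.

  The point is that \<open>E\<close> and \<open>\<Lambda>\<close> have the same infinite paths. The diagonal is cofinal in
  $\mathbb{N}^k$, and an infinite path is determined by its initial segments along any cofinal set of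
  degrees (\<open>inf_path_eqI\<close>); conversely every directed family of finite paths with cofinal
  degrees consists of initial segments of some infinite path (\<open>inf_path_of_directed\<close>). Hence
  restriction to the diagonal is a bijection from the infinite paths of \<open>\<Lambda>\<close> to those of \<open>E\<close>
  (\<open>bij_betw_diag_path\<close>). It commutes with prefixing by paths of \<open>E\<close>. Its inverse is
  continuous, because an infinite path lies in the cylinder of \<open>\<alpha>\<close> exactly if it lies in the cylinder
  of some extension of \<open>\<alpha>\<close> of diagonal degree. Composing \<open>\<Phi>\<close> with this inverse gives an intertwining
  map \<open>\<Psi>\<close> which has, fibre by fibre, the same image as \<open>\<Phi>\<close>.
\<close>

section \<open>Degrees\<close>

lemma vec_nat_le_iff_add: "m \<le> n \<longleftrightarrow> (\<exists>k. n = m + k)" for m n :: "nat ^ 'k"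
proof
  assume "m \<le> n"
  then have "n = m + (n - m)" by (simp add: vec_eq_iff less_eq_vec_def)
  then show "\<exists>k. n = m + k" ..
qed (auto simp: less_eq_vec_def)

lemma vec_nat_zero_le [simp]: "0 \<le> n" for n :: "nat ^ 'k"
  by (simp add: less_eq_vec_def)

lemma vec_nat_le_add [simp]: "m \<le> m + n" "m \<le> n + m" for m n :: "nat ^ 'k"
  by (simp_all add: less_eq_vec_def)

lemma vec_nat_add_diff [simp]: "m + n - m = n" "n + m - m = n" "m - 0 = m" for m n :: "nat ^ 'k"
  by (simp_all add: vec_eq_iff)

section \<open>Initial segments of finite paths\<close>

context small_category
begin

definition is_prefix :: "'m \<Rightarrow> 'm \<Rightarrow> bool" where
  "is_prefix \<alpha> \<omega> \<longleftrightarrow> \<alpha> \<in> Mor G \<and> (\<exists>\<nu>\<in>Mor G. src G \<alpha> = rng G \<nu> \<and> \<omega> = Comp G \<alpha> \<nu>)"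

lemma is_prefixI:
  "\<alpha> \<in> Mor G \<Longrightarrow> \<nu> \<in> Mor G \<Longrightarrow> src G \<alpha> = rng G \<nu> \<Longrightarrow> is_prefix \<alpha> (Comp G \<alpha> \<nu>)"
  by (auto simp: is_prefix_def)

lemma is_prefix_refl: "\<alpha> \<in> Mor G \<Longrightarrow> is_prefix \<alpha> \<alpha>"
  by (metis is_prefix_def Id_in comp_Id rng_Id src_in)

lemma is_prefix_Mor: "is_prefix \<alpha> \<omega> \<Longrightarrow> \<alpha> \<in> Mor G \<and> \<omega> \<in> Mor G"
  by (auto simp: is_prefix_def comp_in)

lemma is_prefix_trans:
  assumes "is_prefix \<alpha> \<beta>" "is_prefix \<beta> \<omega>"
  shows "is_prefix \<alpha> \<omega>"
proof -
  obtain \<mu> where \<mu>: "\<alpha> \<in> Mor G" "\<mu> \<in> Mor G" "src G \<alpha> = rng G \<mu>" "\<beta> = Comp G \<alpha> \<mu>"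
    using assms(1) by (auto simp: is_prefix_def)
  obtain \<nu> where \<nu>: "\<nu> \<in> Mor G" "src G \<beta> = rng G \<nu>" "\<omega> = Comp G \<beta> \<nu>"
    using assms(2) by (auto simp: is_prefix_def)
  have s: "src G \<mu> = rng G \<nu>" using \<mu> \<nu> by (simp add: src_comp)
  have "\<omega> = Comp G \<alpha> (Comp G \<mu> \<nu>)" using \<mu> \<nu> s by (simp add: comp_assoc)
  then show ?thesis
    using \<mu> \<nu> s by (auto simp: is_prefix_def intro!: bexI[of _ "Comp G \<mu> \<nu>"] simp: comp_in rng_comp)
qed

end

context k_graph
begin

lemma factorization_inj:
  assumes "\<mu> \<in> Mor G" "\<nu> \<in> Mor G" "src G \<mu> = rng G \<nu>"
    and "\<mu>' \<in> Mor G" "\<nu>' \<in> Mor G" "src G \<mu>' = rng G \<nu>'"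
    and "Comp G \<mu> \<nu> = Comp G \<mu>' \<nu>'" "deg G \<mu> = deg G \<mu>'"
  shows "\<mu> = \<mu>' \<and> \<nu> = \<nu>'"
proof -
  have d: "deg G (Comp G \<mu> \<nu>) = deg G \<mu> + deg G \<nu>" by (rule deg_comp[OF assms(1-3)])
  have "deg G \<mu> + deg G \<nu> = deg G \<mu>' + deg G \<nu>'" using assms by (metis deg_comp)
  then have "deg G \<nu> = deg G \<nu>'" using assms(8) by (metis vec_nat_add_diff(1))
  moreover have "p = q" if "\<exists>!p. P p" "P p" "P q" for P and p q :: "'m \<times> 'm"
    using that by blast
  note this[OF unique_factorization[OF comp_in[OF assms(1-3)] d], of "(\<mu>, \<nu>)" "(\<mu>', \<nu>')"]
  ultimately show ?thesis using assms by simp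
qed

lemma comp_left_cancel:
  assumes "\<mu> \<in> Mor G" "\<nu> \<in> Mor G" "\<nu>' \<in> Mor G" "src G \<mu> = rng G \<nu>" "src G \<mu> = rng G \<nu>'"
    and "Comp G \<mu> \<nu> = Comp G \<mu> \<nu>'"
  shows "\<nu> = \<nu>'"
  using factorization_inj[of \<mu> \<nu> \<mu> \<nu>'] assms by simp

lemma is_prefix_exists:
  assumes "\<omega> \<in> Mor G" "n \<le> deg G \<omega>"
  shows "\<exists>\<mu>. is_prefix \<mu> \<omega> \<and> deg G \<mu> = n"
proof -
  obtain l where "deg G \<omega> = n + l" using assms(2) vec_nat_le_iff_add by blast
  from unique_factorization[OF assms(1) this] show ?thesis
    unfolding is_prefix_def by blast
qed

lemma is_prefix_unique:
  assumes "is_prefix \<mu> \<omega>" "is_prefix \<mu>' \<omega>" "deg G \<mu> = deg G \<mu>'"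
  shows "\<mu> = \<mu>'"
  using assms unfolding is_prefix_def by (metis factorization_inj)

lemma is_prefix_linear:
  assumes "is_prefix \<mu> \<omega>" "is_prefix \<mu>' \<omega>" "deg G \<mu> \<le> deg G \<mu>'"
  shows "is_prefix \<mu> \<mu>'"
proof -
  obtain \<mu>'' where "is_prefix \<mu>'' \<mu>'" "deg G \<mu>'' = deg G \<mu>"
    using is_prefix_exists[OF _ assms(3)] is_prefix_Mor[OF assms(2)] by blast
  then show ?thesis using is_prefix_unique is_prefix_trans assms by metis
qed

end

section \<open>Infinite paths and their initial segments\<close>

text \<open>The conditions on a functor defined on \<open>Omega\<close>, with the structure of \<open>Omega\<close> eliminated.\<close>

lemma inf_paths_iff:
  fixes G :: "('v, 'm, 'k::finite) kgraph"
  shows "x \<in> inf_paths G \<longleftrightarrow>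
     range (fst x) \<subseteq> Obj G \<and> snd x \<in> {(m, n). m \<le> n} \<rightarrow>\<^sub>E Mor G
   \<and> (\<forall>m n. m \<le> n \<longrightarrow> rng G (snd x (m, n)) = fst x m \<and> src G (snd x (m, n)) = fst x n
                      \<and> deg G (snd x (m, n)) = n - m)
   \<and> (\<forall>m. snd x (m, m) = Ident G (fst x m))
   \<and> (\<forall>l m n. l \<le> m \<longrightarrow> m \<le> n \<longrightarrow> snd x (l, n) = Comp G (snd x (l, m)) (snd x (m, n)))"
proof -
  have ball: "(\<forall>f\<in>{(m, n). m \<le> n}. P f) \<longleftrightarrow> (\<forall>m n. m \<le> n \<longrightarrow> P (m, n))"
    for P :: "(nat ^ 'k) \<times> (nat ^ 'k) \<Rightarrow> bool" by auto
  have comp: "(\<forall>k l. k \<le> l \<longrightarrow> (\<forall>m n. m \<le> n \<longrightarrow> l = m \<longrightarrow> P k l m n))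
      \<longleftrightarrow> (\<forall>l m n. l \<le> m \<longrightarrow> m \<le> n \<longrightarrow> P l m m n)"
    for P :: "nat ^ 'k \<Rightarrow> nat ^ 'k \<Rightarrow> nat ^ 'k \<Rightarrow> nat ^ 'k \<Rightarrow> bool" by blast
  have and_all: "(\<forall>m n. m \<le> n \<longrightarrow> P m n \<and> Q m n) \<longleftrightarrow>
      (\<forall>m n. m \<le> n \<longrightarrow> P m n) \<and> (\<forall>m n. m \<le> n \<longrightarrow> Q m n)"
    for P Q :: "nat ^ 'k \<Rightarrow> nat ^ 'k \<Rightarrow> bool" by blast
  have sub: "F \<in> UNIV \<rightarrow>\<^sub>E Obj G \<longleftrightarrow> range F \<subseteq> Obj G" for F :: "nat ^ 'k \<Rightarrow> 'v"
    by auto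
  show ?thesis
    unfolding inf_paths_def degree_functors_def Omega_def
    by (cases x)
      (simp only: mem_Collect_eq prod.case kgraph.select_convs ball comp and_all sub fst_conv
        snd_conv ball_UNIV conj_assoc conj_commute conj_left_commute)
qed

lemma inf_pathI:
  assumes "\<And>n. fst x n \<in> Obj G" and "snd x \<in> extensional {(m, n). m \<le> n}"
    and "\<And>m n. m \<le> n \<Longrightarrow> snd x (m, n) \<in> Mor G \<and> rng G (snd x (m, n)) = fst x m
           \<and> src G (snd x (m, n)) = fst x n \<and> deg G (snd x (m, n)) = n - m"
    and "\<And>m. snd x (m, m) = Ident G (fst x m)"
    and "\<And>l m n. l \<le> m \<Longrightarrow> m \<le> n \<Longrightarrow> snd x (l, n) = Comp G (snd x (l, m)) (snd x (m, n))"
  shows "x \<in> inf_paths G"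
  unfolding inf_paths_iff PiE_iff using assms by blast

context k_graph
begin

lemma inf_pathD:
  assumes "x \<in> inf_paths G" "m \<le> n"
  shows "snd x (m, n) \<in> Mor G" "rng G (snd x (m, n)) = fst x m" "src G (snd x (m, n)) = fst x n"
    "deg G (snd x (m, n)) = n - m"
  using assms unfolding inf_paths_iff by blast+

lemma inf_path_PiE:
  assumes "x \<in> inf_paths G"
  shows "snd x \<in> {(m, n). m \<le> n} \<rightarrow>\<^sub>E Mor G"
  using assms[unfolded inf_paths_iff] by (elim conjE)

lemma inf_path_vertex:
  assumes "x \<in> inf_paths G"
  shows "fst x n \<in> Obj G" "snd x (n, n) = Ident G (fst x n)"
  using assms unfolding inf_paths_iff by blast+

lemma inf_path_comp:
  assumes "x \<in> inf_paths G" "l \<le> m" "m \<le> n"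
  shows "snd x (l, n) = Comp G (snd x (l, m)) (snd x (m, n))"
  using assms unfolding inf_paths_iff by blast

lemma inf_path_is_prefix:
  assumes "x \<in> inf_paths G" "m \<le> n"
  shows "is_prefix (snd x (0, m)) (snd x (0, n))"
  using inf_path_comp[OF assms(1) vec_nat_zero_le assms(2)]
    inf_pathD[OF assms(1) vec_nat_zero_le, of m] inf_pathD[OF assms]
  by (simp add: is_prefixI)

lemma inf_path_initial_segment:
  assumes "x \<in> inf_paths G" "is_prefix \<alpha> (snd x (0, n))"
  shows "snd x (0, deg G \<alpha>) = \<alpha>"
proof -
  have "deg G (snd x (0, n)) = n" using inf_pathD(4)[OF assms(1), of 0 n] by simp
  then have "deg G \<alpha> \<le> n" using assms(2) by (auto simp: is_prefix_def deg_comp)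
  from inf_path_is_prefix[OF assms(1) this] show ?thesis
    using assms is_prefix_unique inf_pathD(4)[OF assms(1), of 0 "deg G \<alpha>"] by simp
qed

text \<open>Agreement of initial segments passes to shorter ones by unique factorization, so cofinally many
  suffice; the inner segments \<open>x(m, n)\<close> are then recovered by cancelling \<open>x(0, m)\<close> in \<open>x(0, n)\<close>.\<close>

lemma inf_path_eqI:
  assumes x: "x \<in> inf_paths G" and y: "y \<in> inf_paths G"
    and cofinal: "\<And>m. \<exists>n\<ge>m. snd x (0, n) = snd y (0, n)"
  shows "x = y"
proof -
  have init: "snd x (0, m) = snd y (0, m)" for m
  proof -
    obtain n where "m \<le> n" "snd x (0, n) = snd y (0, n)" using cofinal by blast
    then have "is_prefix (snd x (0, m)) (snd y (0, n))"
      using inf_path_is_prefix[OF x] by metis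
    from inf_path_initial_segment[OF y this] show ?thesis
      using inf_pathD(4)[OF x, of 0 m] by simp
  qed
  have obj: "fst x m = fst y m" for m
    using inf_pathD(3)[OF x, of 0 m] inf_pathD(3)[OF y, of 0 m] init by simp
  have "snd x (m, n) = snd y (m, n)" for m n
  proof (cases "m \<le> n")
    case True
    show ?thesis
    proof (rule comp_left_cancel[of "snd x (0, m)"])
      show "Comp G (snd x (0, m)) (snd x (m, n)) = Comp G (snd x (0, m)) (snd y (m, n))"
        using inf_path_comp[OF x, of 0 m n] inf_path_comp[OF y, of 0 m n] True init by simp
    qed (use inf_pathD[OF x] inf_pathD[OF y] True obj in auto)
  next
    case False
    then have outside: "(m, n) \<notin> {(m, n). m \<le> n}" by simp
    show ?thesis
      using PiE_arb[OF inf_path_PiE[OF x] outside] PiE_arb[OF inf_path_PiE[OF y] outside] by simp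
  qed
  then show ?thesis using obj by (auto simp: prod_eq_iff fun_eq_iff)
qed

text \<open>The segment of the infinite path between \<open>m\<close> and \<open>n\<close> is what remains of \<open>f n\<close> after cancelling
  \<open>f m\<close>. For \<open>l \<le> m \<le> n\<close>, the segment from \<open>l\<close> to \<open>n\<close> and the composite of those from \<open>l\<close> to \<open>m\<close>
  and from \<open>m\<close> to \<open>n\<close> both extend \<open>f l\<close> to \<open>f n\<close>, which gives functoriality.\<close>

lemma inf_path_of_initial_segments:
  assumes deg: "\<And>n. deg G (f n) = n"
    and prefix: "\<And>m n. m \<le> n \<Longrightarrow> is_prefix (f m) (f n)"
  shows "\<exists>x\<in>inf_paths G. \<forall>n. snd x (0, n) = f n"
proof -
  have f: "f n \<in> Mor G" for n using prefix[of n n] is_prefix_Mor by blast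
  have "\<forall>m n. \<exists>\<nu>. m \<le> n \<longrightarrow> \<nu> \<in> Mor G \<and> src G (f m) = rng G \<nu> \<and> f n = Comp G (f m) \<nu>"
    using prefix unfolding is_prefix_def by blast
  then obtain g where g: "\<And>m n. m \<le> n \<Longrightarrow>
      g m n \<in> Mor G \<and> src G (f m) = rng G (g m n) \<and> f n = Comp G (f m) (g m n)"
    by metis
  have g_eqI: "\<nu> = g m n"
    if "m \<le> n" "\<nu> \<in> Mor G" "src G (f m) = rng G \<nu>" "f n = Comp G (f m) \<nu>" for m n \<nu>
    using comp_left_cancel[OF f[of m], of \<nu> "g m n"] g[OF that(1)] that by simp
  have src_g: "src G (g m n) = src G (f n)" if "m \<le> n" for m n
    using g[OF that] f by (metis src_comp)
  have deg_g: "deg G (g m n) = n - m" if "m \<le> n" for m n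
  proof -
    have "n = m + deg G (g m n)" using g[OF that] f deg by (metis deg_comp)
    then show ?thesis by (metis vec_nat_add_diff(1))
  qed
  have g_Id: "g m m = Ident G (src G (f m))" for m
    using g_eqI[of m m "Ident G (src G (f m))"] f by (simp add: Id_in src_in rng_Id comp_Id)
  have g_comp: "g l n = Comp G (g l m) (g m n)" if lm: "l \<le> m" and mn: "m \<le> n" for l m n
  proof -
    have s: "src G (g l m) = rng G (g m n)" using src_g[OF lm] g[OF mn] by simp
    have "Comp G (f l) (Comp G (g l m) (g m n)) = f n"
      using comp_assoc[OF f[of l], of "g l m" "g m n"] g[OF lm] g[OF mn] s by simp
    then show ?thesis
      using g_eqI[of l n "Comp G (g l m) (g m n)"] g[OF lm] g[OF mn] s lm mn
      by (simp add: comp_in rng_comp)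
  qed
  have zero: "f 0 = Ident G (src G (f 0))"
  proof -
    \<comment> \<open>Both \<open>f 0\<close> and the identity at its range are initial segments of \<open>f 0\<close> of degree \<open>0\<close>.\<close>
    have "is_prefix (Ident G (rng G (f 0))) (f 0)"
      using is_prefixI[of "Ident G (rng G (f 0))" "f 0"] f[of 0]
      by (simp add: Id_comp Id_in rng_in src_Id)
    then have "Ident G (rng G (f 0)) = f 0"
      using is_prefix_unique prefix[of 0 0] deg[of 0] f[of 0] by (simp add: deg_Id rng_in)
    then show ?thesis using f[of 0] by (metis src_Id rng_in)
  qed
  have g_zero: "g 0 n = f n" for n
    using g[of 0 n] zero f[of 0] by (metis Id_comp rng_Id src_in vec_nat_zero_le)
  define x where "x = ((\<lambda>n. src G (f n)), restrict (\<lambda>(m, n). g m n) {(m, n). m \<le> n})"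
  have "x \<in> inf_paths G"
  proof (rule inf_pathI)
    show "snd x (l, n) = Comp G (snd x (l, m)) (snd x (m, n))" if "l \<le> m" "m \<le> n" for l m n
      using that g_comp[OF that] order_trans[OF that] by (simp add: x_def)
    show "snd x (m, n) \<in> Mor G \<and> rng G (snd x (m, n)) = fst x m \<and> src G (snd x (m, n)) = fst x n
        \<and> deg G (snd x (m, n)) = n - m" if "m \<le> n" for m n
      using that g[OF that] src_g[OF that] deg_g[OF that] by (simp add: x_def)
  qed (simp_all add: x_def f src_in g_Id)
  moreover have "\<forall>n. snd x (0, n) = f n" by (simp add: x_def g_zero)
  ultimately show ?thesis by blast
qed

text \<open>Any two members of the family of degree at least \<open>n\<close> have a common extension, hence the same
  initial segment of degree \<open>n\<close>; these segments extend one another and so form an infinite path.\<close>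

lemma inf_path_of_directed:
  assumes S: "S \<subseteq> Mor G"
    and cofinal: "\<And>n. \<exists>\<omega>\<in>S. n \<le> deg G \<omega>"
    and directed: "\<And>\<omega> \<omega>'. \<omega> \<in> S \<Longrightarrow> \<omega>' \<in> S \<Longrightarrow> \<exists>\<zeta>\<in>S. is_prefix \<omega> \<zeta> \<and> is_prefix \<omega>' \<zeta>"
  shows "\<exists>x\<in>inf_paths G. \<forall>\<omega>\<in>S. snd x (0, deg G \<omega>) = \<omega>"
proof -
  have "\<forall>n. \<exists>\<mu>. deg G \<mu> = n \<and> (\<exists>\<omega>\<in>S. is_prefix \<mu> \<omega>)"
    using cofinal is_prefix_exists S by (meson subsetD)
  then obtain f where deg_f: "\<And>n. deg G (f n) = n" and f: "\<And>n. \<exists>\<omega>\<in>S. is_prefix (f n) \<omega>"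
    by metis
  have common: "\<exists>\<zeta>\<in>S. is_prefix \<mu> \<zeta> \<and> is_prefix \<mu>' \<zeta>"
    if "\<exists>\<omega>\<in>S. is_prefix \<mu> \<omega>" "\<exists>\<omega>\<in>S. is_prefix \<mu>' \<omega>" for \<mu> \<mu>'
    using that directed is_prefix_trans by meson
  have "is_prefix (f m) (f n)" if "m \<le> n" for m n
    using common[OF f f, of m n] is_prefix_linear that deg_f by metis
  from inf_path_of_initial_segments[OF deg_f this]
  obtain x where x: "x \<in> inf_paths G" "\<And>n. snd x (0, n) = f n" by blast
  have "f (deg G \<omega>) = \<omega>" if "\<omega> \<in> S" for \<omega>
    using common[OF f, of \<omega> "deg G \<omega>"] is_prefix_refl is_prefix_unique that deg_f S
    by (metis subsetD)
  then show ?thesis using x(1) by (intro bexI[of _ x]) (simp_all add: x(2))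
qed

section \<open>Prefixing, shifting and cylinder sets\<close>

lemma prefix_path_exists:
  assumes \<alpha>: "\<alpha> \<in> Mor G" and x: "x \<in> inf_paths_at G (src G \<alpha>)"
  shows "\<exists>y\<in>inf_paths G. \<forall>n. snd y (0, deg G \<alpha> + n) = Comp G \<alpha> (snd x (0, n))"
proof -
  have x': "x \<in> inf_paths G" "fst x 0 = src G \<alpha>"
    using x by (auto simp: inf_paths_at_def path_range_def)
  let ?w = "\<lambda>n. Comp G \<alpha> (snd x (0, n))"
  have w: "?w n \<in> Mor G" "deg G (?w n) = deg G \<alpha> + n" for n
    using \<alpha> x' inf_pathD[OF x'(1), of 0 n] by (simp_all add: comp_in deg_comp)
  have w_prefix: "is_prefix (?w m) (?w (m + n))" for m n
  proof -
    have "?w (m + n) = Comp G (?w m) (snd x (m, m + n))"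
      using \<alpha> x' inf_pathD[OF x'(1), of 0 m] inf_pathD[OF x'(1), of m "m + n"]
        inf_path_comp[OF x'(1), of 0 m "m + n"]
      by (simp add: comp_assoc)
    then show ?thesis
      using is_prefixI[of "?w m" "snd x (m, m + n)"] w x' \<alpha>
        inf_pathD[OF x'(1), of 0 m] inf_pathD[OF x'(1), of m "m + n"]
      by (simp add: src_comp)
  qed
  have "\<exists>y\<in>inf_paths G. \<forall>\<omega>\<in>range ?w. snd y (0, deg G \<omega>) = \<omega>"
  proof (rule inf_path_of_directed)
    show "\<exists>\<omega>\<in>range ?w. n \<le> deg G \<omega>" for n using w(2)[of n] by (metis rangeI vec_nat_le_add(2))
    show "\<exists>\<zeta>\<in>range ?w. is_prefix \<omega> \<zeta> \<and> is_prefix \<omega>' \<zeta>"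
      if "\<omega> \<in> range ?w" "\<omega>' \<in> range ?w" for \<omega> \<omega>'
      using that w_prefix by (metis (no_types, lifting) add.commute imageE rangeI)
  qed (use w in auto)
  then show ?thesis using w by auto
qed

text \<open>The path $\alpha x$ is determined by its initial segments $\alpha\, x(0, n)$, since the degrees
  $d(\alpha) + n$ are cofinal. This replaces the description by shifts, and contains it: cancelling
  $\alpha\, x(0, m)$ in $\alpha\, x(0, n)$ leaves $x(m, n)$.\<close>

lemma prefix_path_eqI:
  assumes \<alpha>: "\<alpha> \<in> Mor G" and x: "x \<in> inf_paths_at G (src G \<alpha>)"
    and y: "y \<in> inf_paths G"
    and y_init: "\<And>n. snd y (0, deg G \<alpha> + n) = Comp G \<alpha> (snd x (0, n))"
  shows "prefix_path G \<alpha> x = y"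
  unfolding prefix_path_def
proof (rule the_equality)
  have x': "x \<in> inf_paths G" "fst x 0 = src G \<alpha>"
    using x by (auto simp: inf_paths_at_def path_range_def)
  have y_deg: "snd y (0, deg G \<alpha>) = \<alpha>"
    using y_init[of 0] inf_path_vertex(2)[OF x'(1), of 0] x'(2) \<alpha> by (simp add: comp_Id)
  have shift: "snd y (m + deg G \<alpha>, n + deg G \<alpha>) = snd x (m, n)" if mn: "m \<le> n" for m n
  proof -
    have mn': "deg G \<alpha> + m \<le> deg G \<alpha> + n" using mn by (simp add: less_eq_vec_def)
    note X0 = inf_pathD[OF x'(1) vec_nat_zero_le, of m] and X = inf_pathD[OF x'(1) mn]
    note Y0 = inf_pathD[OF y vec_nat_zero_le, of "deg G \<alpha> + m"] and Y = inf_pathD[OF y mn']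
    have "Comp G (snd y (0, deg G \<alpha> + m)) (snd y (deg G \<alpha> + m, deg G \<alpha> + n))
        = Comp G (snd y (0, deg G \<alpha> + m)) (snd x (m, n))"
      using inf_path_comp[OF y vec_nat_zero_le mn'] inf_path_comp[OF x'(1) vec_nat_zero_le mn]
        y_init X0 X x' \<alpha> by (simp add: comp_assoc)
    moreover have "src G (snd y (0, deg G \<alpha> + m)) = rng G (snd x (m, n))"
      using y_init X0 X x' \<alpha> by (simp add: src_comp)
    ultimately have "snd y (deg G \<alpha> + m, deg G \<alpha> + n) = snd x (m, n)"
      using comp_left_cancel X Y0 Y by metis
    then show ?thesis by (simp add: add.commute)
  qed
  show "y \<in> inf_paths G \<and> snd y (0, deg G \<alpha>) = \<alpha>
      \<and> (\<forall>m n. m \<le> n \<longrightarrow> snd y (m + deg G \<alpha>, n + deg G \<alpha>) = snd x (m, n))"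
    using y y_deg shift by blast
  fix z
  assume z: "z \<in> inf_paths G \<and> snd z (0, deg G \<alpha>) = \<alpha>
      \<and> (\<forall>m n. m \<le> n \<longrightarrow> snd z (m + deg G \<alpha>, n + deg G \<alpha>) = snd x (m, n))"
  have "snd z (0, n + deg G \<alpha>) = Comp G \<alpha> (snd x (0, n))" for n
    using z inf_path_comp[of z 0 "deg G \<alpha>" "n + deg G \<alpha>"]
    by (metis add_0 vec_nat_le_add(2) vec_nat_zero_le)
  then have "snd z (0, n + deg G \<alpha>) = snd y (0, n + deg G \<alpha>)" for n
    using y_init by (simp add: add.commute)
  then show "z = y"
    using inf_path_eqI[of z y] z y vec_nat_le_add(1) by blast
qed

lemma prefix_path:
  assumes "\<alpha> \<in> Mor G" "x \<in> inf_paths_at G (src G \<alpha>)"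
  shows "prefix_path G \<alpha> x \<in> inf_paths G"
    and "snd (prefix_path G \<alpha> x) (0, deg G \<alpha> + n) = Comp G \<alpha> (snd x (0, n))"
  using prefix_path_exists[OF assms] prefix_path_eqI[OF assms] by metis+

lemma shift_exists:
  assumes y: "y \<in> inf_paths G"
  shows "\<exists>x\<in>inf_paths G. \<forall>n. snd x (0, n) = snd y (d, d + n)"
proof (rule inf_path_of_initial_segments)
  fix m n :: "nat ^ 'k"
  show "deg G (snd y (d, d + n)) = n" using inf_pathD(4)[OF y, of d "d + n"] by simp
  assume "m \<le> n"
  then have mn: "d \<le> d + m" "d + m \<le> d + n" by (simp_all add: less_eq_vec_def)
  show "is_prefix (snd y (d, d + m)) (snd y (d, d + n))"
    using inf_path_comp[OF y mn] inf_pathD[OF y mn(1)] inf_pathD[OF y mn(2)]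
    by (simp add: is_prefixI)
qed

definition cylinder :: "'m \<Rightarrow> ('v, 'm, 'k) path set" where
  "cylinder \<alpha> = {y \<in> inf_paths G. snd y (0, deg G \<alpha>) = \<alpha>}"

lemma prefix_path_image:
  assumes \<alpha>: "\<alpha> \<in> Mor G"
  shows "prefix_path G \<alpha> ` inf_paths_at G (src G \<alpha>) = cylinder \<alpha>"
proof (intro equalityI subsetI)
  fix y assume "y \<in> prefix_path G \<alpha> ` inf_paths_at G (src G \<alpha>)"
  then obtain x where x: "x \<in> inf_paths_at G (src G \<alpha>)" "y = prefix_path G \<alpha> x" by blast
  have "snd x (0, 0) = Ident G (src G \<alpha>)"
    using x inf_path_vertex(2)[of x 0] by (auto simp: inf_paths_at_def path_range_def)
  then show "y \<in> cylinder \<alpha>"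
    using prefix_path(1)[OF \<alpha> x(1)] prefix_path(2)[OF \<alpha> x(1), of 0] x(2) \<alpha>
    by (simp add: cylinder_def comp_Id)
next
  fix y assume "y \<in> cylinder \<alpha>"
  then have y: "y \<in> inf_paths G" "snd y (0, deg G \<alpha>) = \<alpha>" by (auto simp: cylinder_def)
  obtain x where x: "x \<in> inf_paths G" "\<And>n. snd x (0, n) = snd y (deg G \<alpha>, deg G \<alpha> + n)"
    using shift_exists[OF y(1)] by blast
  have "fst x 0 = src G \<alpha>"
    using inf_pathD(2)[OF x(1), of 0 0] x(2)[of 0] y
      inf_pathD(2)[OF y(1), of "deg G \<alpha>" "deg G \<alpha>"] inf_pathD(3)[OF y(1), of 0 "deg G \<alpha>"]
    by simp
  then have x_at: "x \<in> inf_paths_at G (src G \<alpha>)"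
    using x by (simp add: inf_paths_at_def path_range_def)
  have "prefix_path G \<alpha> x = y"
  proof (rule prefix_path_eqI[OF \<alpha> x_at y(1)])
    show "snd y (0, deg G \<alpha> + n) = Comp G \<alpha> (snd x (0, n))" for n
      using inf_path_comp[OF y(1), of 0 "deg G \<alpha>" "deg G \<alpha> + n"] x(2) y(2) by simp
  qed
  then show "y \<in> prefix_path G \<alpha> ` inf_paths_at G (src G \<alpha>)" using x_at by blast
qed

lemma path_topology_cylinders: "path_topology G = topology_generated_by (cylinder ` Mor G)"
  unfolding path_topology_def using prefix_path_image by (simp cong: image_cong_simp)

lemma topspace_path_topology: "topspace (path_topology G) = inf_paths G"
proof -
  have "\<exists>\<alpha>\<in>Mor G. y \<in> cylinder \<alpha>" if "y \<in> inf_paths G" for y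
    using that inf_pathD[OF that, of 0 0]
    by (intro bexI[of _ "snd y (0, 0)"]) (simp_all add: cylinder_def)
  then show ?thesis
    by (auto simp: path_topology_cylinders cylinder_def)
qed

lemma openin_cylinder: "\<alpha> \<in> Mor G \<Longrightarrow> openin (path_topology G) (cylinder \<alpha>)"
  unfolding path_topology_cylinders by (rule topology_generated_by_Basis) simp

end

section \<open>The 1-graph of paths of diagonal degree\<close>

definition diag :: "nat ^ 1 \<Rightarrow> nat ^ 'k::finite" where
  "diag a = (\<chi> i. a $ 1)"

lemma diag_add: "diag (a + b) = diag a + diag b"
  by (simp add: diag_def vec_eq_iff)

lemma diag_diff: "diag (a - b) = diag a - diag b"
  by (simp add: diag_def vec_eq_iff)

lemma diag_zero [simp]: "diag 0 = 0"
  by (simp add: diag_def vec_eq_iff)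

lemma diag_mono: "a \<le> b \<Longrightarrow> diag a \<le> diag b"
  by (auto simp: diag_def less_eq_vec_def)

lemma diag_cofinal: "\<exists>a. n \<le> diag a"
proof
  show "n \<le> diag (\<chi> i. Max (range (($) n)))"
    by (auto simp: diag_def less_eq_vec_def)
qed

text \<open>All entries of a diagonal degree coincide, so the length of a path of \<open>diag_graph\<close> can be read off
  at any index, here at \<open>undefined\<close>.\<close>

definition diag_graph :: "('v, 'm, 'k::finite) kgraph \<Rightarrow> ('v, 'm, 1) kgraph" where
  "diag_graph G = \<lparr>Obj = Obj G, Mor = {\<alpha> \<in> Mor G. deg G \<alpha> \<in> range diag}, rng = rng G, src = src G,
     Ident = Ident G, Comp = Comp G, deg = (\<lambda>\<alpha>. \<chi> i. deg G \<alpha> $ undefined)\<rparr>"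

lemma diag_graph_simps [simp]:
  "Obj (diag_graph G) = Obj G" "rng (diag_graph G) = rng G" "src (diag_graph G) = src G"
  "Ident (diag_graph G) = Ident G" "Comp (diag_graph G) = Comp G"
  by (simp_all add: diag_graph_def)

lemma deg_diag_graph_iff:
  "\<alpha> \<in> Mor (diag_graph G) \<and> deg (diag_graph G) \<alpha> = a \<longleftrightarrow> \<alpha> \<in> Mor G \<and> deg G \<alpha> = diag a"
  by (auto simp: diag_graph_def diag_def vec_eq_iff)

lemma diag_deg: "\<alpha> \<in> Mor (diag_graph G) \<Longrightarrow> \<alpha> \<in> Mor G \<and> deg G \<alpha> = diag (deg (diag_graph G) \<alpha>)"
  using deg_diag_graph_iff[of \<alpha> G "deg (diag_graph G) \<alpha>"] by simp

lemma k_graph_diag_graph: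
  assumes "k_graph G"
  shows "k_graph (diag_graph G)"
proof -
  interpret k_graph G by fact
  note mem = deg_diag_graph_iff[of _ G]
  have Id: "Ident G v \<in> Mor (diag_graph G) \<and> deg (diag_graph G) (Ident G v) = 0"
    if "v \<in> Obj G" for v
    using that by (simp add: mem Id_in deg_Id)
  have comp: "Comp G \<alpha> \<mu> \<in> Mor (diag_graph G) \<and>
      deg (diag_graph G) (Comp G \<alpha> \<mu>) = deg (diag_graph G) \<alpha> + deg (diag_graph G) \<mu>"
    if "\<alpha> \<in> Mor (diag_graph G)" "\<mu> \<in> Mor (diag_graph G)" "src G \<alpha> = rng G \<mu>" for \<alpha> \<mu>
    using that by (simp only: mem diag_add) (simp add: diag_deg comp_in deg_comp)
  show ?thesis
  proof
    show "countable (Mor (diag_graph G))"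
      by (rule countable_subset[OF _ countable_Mor]) (auto dest: diag_deg)
    fix \<alpha> m n
    assume "\<alpha> \<in> Mor (diag_graph G)" "deg (diag_graph G) \<alpha> = m + n"
    then have "\<alpha> \<in> Mor G" "deg G \<alpha> = diag m + diag n"
      using mem[of \<alpha> "m + n"] by (simp_all add: diag_add)
    note factorization = unique_factorization[OF this]
    have eq: "\<mu> \<in> Mor (diag_graph G) \<and> \<nu> \<in> Mor (diag_graph G) \<and> src G \<mu> = rng G \<nu>
        \<and> deg (diag_graph G) \<mu> = m \<and> deg (diag_graph G) \<nu> = n \<and> \<alpha> = Comp G \<mu> \<nu>
      \<longleftrightarrow> \<mu> \<in> Mor G \<and> \<nu> \<in> Mor G \<and> src G \<mu> = rng G \<nu>
        \<and> deg G \<mu> = diag m \<and> deg G \<nu> = diag n \<and> \<alpha> = Comp G \<mu> \<nu>" for \<mu> \<nu>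
      using mem[of \<mu> m] mem[of \<nu> n] by argo
    show "\<exists>!(\<mu>, \<nu>). \<mu> \<in> Mor (diag_graph G) \<and> \<nu> \<in> Mor (diag_graph G)
        \<and> src (diag_graph G) \<mu> = rng (diag_graph G) \<nu> \<and> deg (diag_graph G) \<mu> = m
        \<and> deg (diag_graph G) \<nu> = n \<and> \<alpha> = Comp (diag_graph G) \<mu> \<nu>"
      unfolding diag_graph_simps eq by (rule factorization)
  qed (use Id comp in \<open>auto dest!: diag_deg simp: rng_in src_in rng_Id src_Id rng_comp src_comp
        comp_assoc Id_comp comp_Id countable_Obj\<close>)
qed

lemma row_finite_no_sources_diag_graph:
  assumes "row_finite_no_sources G"
  shows "row_finite_no_sources (diag_graph G)"
proof -
  have "{\<alpha> \<in> Mor (diag_graph G). rng G \<alpha> = v \<and> deg (diag_graph G) \<alpha> = a}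
      = {\<alpha> \<in> Mor G. rng G \<alpha> = v \<and> deg G \<alpha> = diag a}" for v a
    using deg_diag_graph_iff[of _ G a] by blast
  then show ?thesis using assms by (simp add: row_finite_no_sources_def)
qed

lemma system_of_maps_diag_graph:
  "system_of_maps G T \<sigma> \<Longrightarrow> system_of_maps (diag_graph G) T \<sigma>"
  by (auto simp: system_of_maps_def dest!: diag_deg)

section \<open>Restriction of infinite paths to the diagonal\<close>

definition diag_path :: "('v, 'm, 'k::finite) path \<Rightarrow> ('v, 'm, 1) path" where
  "diag_path x =
     ((\<lambda>a. fst x (diag a)), restrict (\<lambda>(a, b). snd x (diag a, diag b)) {(a, b). a \<le> b})"

lemma snd_diag_path [simp]: "a \<le> b \<Longrightarrow> snd (diag_path x) (a, b) = snd x (diag a, diag b)"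
  by (simp add: diag_path_def)

lemma path_range_diag_path [simp]: "path_range (diag_path x) = path_range x"
  by (simp add: path_range_def diag_path_def)

context k_graph
begin

lemma inf_path_diag_segment:
  assumes "x \<in> inf_paths G" "a \<le> b"
  shows "snd x (diag a, diag b) \<in> Mor (diag_graph G)
    \<and> deg (diag_graph G) (snd x (diag a, diag b)) = b - a"
  using inf_pathD[OF assms(1) diag_mono[OF assms(2)]]
  by (simp add: deg_diag_graph_iff diag_diff)

lemma diag_path_in_inf_paths:
  assumes x: "x \<in> inf_paths G"
  shows "diag_path x \<in> inf_paths (diag_graph G)"
proof -
  show ?thesis
  proof (rule inf_pathI)
    show "snd (diag_path x) (a, c)
        = Comp (diag_graph G) (snd (diag_path x) (a, b)) (snd (diag_path x) (b, c))"
      if "a \<le> b" "b \<le> c" for a b c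
      using that order_trans[OF that] inf_path_comp[OF x that[THEN diag_mono]] by simp
    show "snd (diag_path x) (a, b) \<in> Mor (diag_graph G)
        \<and> rng (diag_graph G) (snd (diag_path x) (a, b)) = fst (diag_path x) a
        \<and> src (diag_graph G) (snd (diag_path x) (a, b)) = fst (diag_path x) b
        \<and> deg (diag_graph G) (snd (diag_path x) (a, b)) = b - a" if "a \<le> b" for a b
      using that inf_path_diag_segment[OF x that] inf_pathD[OF x diag_mono[OF that]]
      by (simp add: diag_path_def)
  qed (use inf_path_vertex[OF x] in \<open>auto simp: diag_path_def\<close>)
qed

lemma bij_betw_diag_path: "bij_betw diag_path (inf_paths G) (inf_paths (diag_graph G))"
proof -
  interpret E: k_graph "diag_graph G" by (rule k_graph_diag_graph) unfold_locales
  have inj: "x = y" if x: "x \<in> inf_paths G" and y: "y \<in> inf_paths G"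
    and eq: "diag_path x = diag_path y" for x y
  proof (rule inf_path_eqI[OF x y])
    fix m :: "nat ^ 'k"
    obtain a :: "nat ^ 1" where a: "m \<le> diag a" using diag_cofinal by blast
    have "snd x (0, diag a) = snd y (0, diag a)"
      using eq snd_diag_path[of 0 a x] snd_diag_path[of 0 a y] by simp
    then show "\<exists>n\<ge>m. snd x (0, n) = snd y (0, n)" using a by blast
  qed
  have surj: "\<exists>x\<in>inf_paths G. diag_path x = z" if z: "z \<in> inf_paths (diag_graph G)" for z
  proof -
    let ?w = "\<lambda>a. snd z (0, a)"
    have w: "?w a \<in> Mor G" "deg G (?w a) = diag a" for a
      using E.inf_pathD[OF z, of 0 a] diag_deg[of "?w a" G] by simp_all
    have w_prefix: "is_prefix (?w a) (?w b)" if "a \<le> b" for a b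
      using E.inf_path_is_prefix[OF z that] diag_deg
      unfolding E.is_prefix_def is_prefix_def diag_graph_simps by metis
    have "\<exists>x\<in>inf_paths G. \<forall>\<omega>\<in>range ?w. snd x (0, deg G \<omega>) = \<omega>"
    proof (rule inf_path_of_directed)
      show "\<exists>\<omega>\<in>range ?w. n \<le> deg G \<omega>" for n using w(2) diag_cofinal[of n] by auto
      show "\<exists>\<zeta>\<in>range ?w. is_prefix \<omega> \<zeta> \<and> is_prefix \<omega>' \<zeta>"
        if "\<omega> \<in> range ?w" "\<omega>' \<in> range ?w" for \<omega> \<omega>'
        using that w_prefix vec_nat_le_add by blast
    qed (use w in auto)
    then obtain x where x: "x \<in> inf_paths G" "\<And>a. snd x (0, diag a) = ?w a"
      using w(2) by auto
    have "diag_path x = z"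
      using E.inf_path_eqI[OF diag_path_in_inf_paths[OF x(1)] z] x(2) by auto
    then show ?thesis using x(1) by blast
  qed
  show ?thesis
    unfolding bij_betw_def inj_on_def using inj surj diag_path_in_inf_paths by blast
qed

text \<open>Both sides have the initial segments $\alpha\, x(0, \mathrm{diag}\, a)$.\<close>

lemma diag_path_prefix_path:
  assumes \<alpha>: "\<alpha> \<in> Mor (diag_graph G)" and x: "x \<in> inf_paths_at G (src G \<alpha>)"
  shows "prefix_path (diag_graph G) \<alpha> (diag_path x) = diag_path (prefix_path G \<alpha> x)"
proof -
  interpret E: k_graph "diag_graph G" by (rule k_graph_diag_graph) unfold_locales
  have \<alpha>': "\<alpha> \<in> Mor G" "deg G \<alpha> = diag (deg (diag_graph G) \<alpha>)" using diag_deg[OF \<alpha>] by auto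
  show ?thesis
  proof (rule E.prefix_path_eqI[OF \<alpha>])
    show "diag_path x \<in> inf_paths_at (diag_graph G) (src (diag_graph G) \<alpha>)"
      using x diag_path_in_inf_paths by (simp add: inf_paths_at_def)
    show "diag_path (prefix_path G \<alpha> x) \<in> inf_paths (diag_graph G)"
      by (rule diag_path_in_inf_paths[OF prefix_path(1)[OF \<alpha>'(1) x]])
    show "snd (diag_path (prefix_path G \<alpha> x)) (0, deg (diag_graph G) \<alpha> + a)
        = Comp (diag_graph G) \<alpha> (snd (diag_path x) (0, a))" for a
      using prefix_path(2)[OF \<alpha>'(1) x, of "diag a"] \<alpha>'(2) by (simp add: diag_add)
  qed
qed

definition undiag_path :: "('v, 'm, 1) path \<Rightarrow> ('v, 'm, 'k) path" where
  "undiag_path = inv_into (inf_paths G) diag_path"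

lemma undiag_diag_path: "x \<in> inf_paths G \<Longrightarrow> undiag_path (diag_path x) = x"
  using bij_betw_diag_path by (simp add: undiag_path_def bij_betw_def)

lemma undiag_path:
  assumes "z \<in> inf_paths (diag_graph G)"
  shows "undiag_path z \<in> inf_paths G" "diag_path (undiag_path z) = z"
  using assms bij_betw_diag_path
  by (metis bij_betw_def undiag_path_def inv_into_into f_inv_into_f)+

lemma undiag_path_image:
  "undiag_path ` inf_paths_at (diag_graph G) v = inf_paths_at G v"
proof (intro equalityI subsetI)
  fix x assume "x \<in> inf_paths_at G v"
  then have "x = undiag_path (diag_path x)" "diag_path x \<in> inf_paths_at (diag_graph G) v"
    by (auto simp: inf_paths_at_def undiag_diag_path diag_path_in_inf_paths)
  then show "x \<in> undiag_path ` inf_paths_at (diag_graph G) v" by blast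
next
  fix x assume "x \<in> undiag_path ` inf_paths_at (diag_graph G) v"
  then obtain z where z: "z \<in> inf_paths (diag_graph G)" "path_range z = v" "x = undiag_path z"
    by (auto simp: inf_paths_at_def)
  then have "path_range x = v" using undiag_path(2)[OF z(1)] path_range_diag_path by metis
  then show "x \<in> inf_paths_at G v" using undiag_path(1)[OF z(1)] z(3) by (simp add: inf_paths_at_def)
qed

text \<open>The cylinder of \<open>\<alpha>\<close> is the union of the cylinders of those extensions of \<open>\<alpha>\<close> that have diagonal
  degree, because every infinite path through \<open>\<alpha>\<close> has initial segments of arbitrarily large diagonal
  degree; and the cylinders of paths of \<open>diag_graph G\<close> correspond in the two path spaces.\<close>

lemma undiag_path_vimage_cylinder:
  "{z \<in> inf_paths (diag_graph G). undiag_path z \<in> cylinder \<alpha>}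
   = (\<Union>\<omega>\<in>{\<omega> \<in> Mor (diag_graph G). is_prefix \<alpha> \<omega>}. k_graph.cylinder (diag_graph G) \<omega>)"
  (is "?L = ?R")
proof -
  interpret E: k_graph "diag_graph G" by (rule k_graph_diag_graph) unfold_locales
  have init: "snd z (0, a) = snd (undiag_path z) (0, diag a)"
    if "z \<in> inf_paths (diag_graph G)" for z a
    using undiag_path(2)[OF that] snd_diag_path[of 0 a "undiag_path z"] by simp
  show ?thesis
  proof (intro equalityI subsetI)
    fix z assume "z \<in> ?L"
    then have z: "z \<in> inf_paths (diag_graph G)" and x: "undiag_path z \<in> inf_paths G"
      and \<alpha>: "snd (undiag_path z) (0, deg G \<alpha>) = \<alpha>" by (auto simp: cylinder_def)
    obtain a :: "nat ^ 1" where a: "deg G \<alpha> \<le> diag a" using diag_cofinal by blast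
    have "is_prefix \<alpha> (snd z (0, a))"
      using inf_path_is_prefix[OF x a] \<alpha> init[OF z] by simp
    moreover have "snd z (0, a) \<in> Mor (diag_graph G)" "z \<in> E.cylinder (snd z (0, a))"
      using E.inf_pathD[OF z, of 0 a] z by (simp_all add: E.cylinder_def)
    ultimately show "z \<in> ?R" by blast
  next
    fix z assume "z \<in> ?R"
    then obtain \<omega> where \<omega>: "is_prefix \<alpha> \<omega>" and z: "z \<in> inf_paths (diag_graph G)"
      and "snd z (0, deg (diag_graph G) \<omega>) = \<omega>" by (auto simp: E.cylinder_def)
    then have "is_prefix \<alpha> (snd (undiag_path z) (0, diag (deg (diag_graph G) \<omega>)))"
      using init[OF z] by simp
    from inf_path_initial_segment[OF undiag_path(1)[OF z] this]
    show "z \<in> ?L" using z undiag_path(1)[OF z] by (simp add: cylinder_def)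
  qed
qed

lemma continuous_map_undiag_path:
  "continuous_map (path_topology (diag_graph G)) (path_topology G) undiag_path"
proof -
  interpret E: k_graph "diag_graph G" by (rule k_graph_diag_graph) unfold_locales
  show ?thesis
    unfolding path_topology_cylinders
  proof (rule continuous_on_generated_topo)
    fix U assume "U \<in> cylinder ` Mor G"
    then obtain \<alpha> where "U = cylinder \<alpha>" by blast
    then have "undiag_path -` U \<inter> topspace (path_topology (diag_graph G))
        = (\<Union>\<omega>\<in>{\<omega> \<in> Mor (diag_graph G). is_prefix \<alpha> \<omega>}. E.cylinder \<omega>)"
      unfolding undiag_path_vimage_cylinder[symmetric] E.topspace_path_topology by blast
    then show "openin (path_topology (diag_graph G))
        (undiag_path -` U \<inter> topspace (path_topology (diag_graph G)))"
      using E.openin_cylinder by auto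
  next
    have "\<Union> (cylinder ` Mor G) = inf_paths G"
      using topspace_path_topology by (simp add: path_topology_cylinders)
    then show "undiag_path ` topspace (path_topology (diag_graph G)) \<subseteq> \<Union> (cylinder ` Mor G)"
      using undiag_path(1) by (auto simp: E.topspace_path_topology)
  qed
qed

lemma undiag_path_prefix_path:
  assumes \<alpha>: "\<alpha> \<in> Mor (diag_graph G)" and z: "z \<in> inf_paths_at (diag_graph G) (src G \<alpha>)"
  shows "undiag_path (prefix_path (diag_graph G) \<alpha> z) = prefix_path G \<alpha> (undiag_path z)"
proof -
  have x: "undiag_path z \<in> inf_paths_at G (src G \<alpha>)" using z undiag_path_image by blast
  have "z \<in> inf_paths (diag_graph G)" using z by (simp add: inf_paths_at_def)
  then have "prefix_path (diag_graph G) \<alpha> z = diag_path (prefix_path G \<alpha> (undiag_path z))"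
    using diag_path_prefix_path[OF \<alpha> x] undiag_path(2) by simp
  then show ?thesis
    using undiag_diag_path prefix_path(1)[OF _ x] diag_deg[OF \<alpha>] by simp
qed

lemma attractor_diag_graph: "attractor (diag_graph G) (\<Phi> \<circ> undiag_path) = attractor G \<Phi>"
  unfolding attractor_def image_comp[symmetric] undiag_path_image diag_graph_simps ..

lemma intertwining_diag_graph:
  assumes "intertwining G T \<sigma> \<Phi>"
  shows "intertwining (diag_graph G) T \<sigma> (\<Phi> \<circ> undiag_path)"
  unfolding intertwining_def
proof (intro conjI ballI)
  show "continuous_map (path_topology (diag_graph G)) (sum_topology T (Obj (diag_graph G)))
      (\<Phi> \<circ> undiag_path)"
    by (rule continuous_map_compose[OF continuous_map_undiag_path])
      (use assms in \<open>simp add: intertwining_def\<close>)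
  show "(\<Phi> \<circ> undiag_path) ` inf_paths_at (diag_graph G) v \<subseteq> {v} \<times> topspace (T v)"
    if "v \<in> Obj (diag_graph G)" for v
    using that assms unfolding image_comp[symmetric] undiag_path_image
    by (simp add: intertwining_def)
  show "(\<Phi> \<circ> undiag_path) (prefix_path (diag_graph G) \<alpha> z)
      = (rng (diag_graph G) \<alpha>, \<sigma> \<alpha> (snd ((\<Phi> \<circ> undiag_path) z)))"
    if \<alpha>: "\<alpha> \<in> Mor (diag_graph G)" and z: "z \<in> inf_paths_at (diag_graph G) (src (diag_graph G) \<alpha>)"
    for \<alpha> z
  proof -
    have z': "z \<in> inf_paths_at (diag_graph G) (src G \<alpha>)" using z by simp
    then have "undiag_path z \<in> inf_paths_at G (src G \<alpha>)" using undiag_path_image by blast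
    then show ?thesis
      using assms diag_deg[OF \<alpha>] undiag_path_prefix_path[OF \<alpha> z'] by (simp add: intertwining_def)
  qed
qed

end

section \<open>Attractors of higher-rank graphs are attractors of 1-graphs\<close>

theorem theorem8p5:
  fixes \<Lambda> :: "('v, 'm, 'k::finite) kgraph"
    and T :: "'v \<Rightarrow> 't topology"
    and \<sigma> :: "'m \<Rightarrow> 't \<Rightarrow> 't"
    and \<Phi> :: "('v, 'm, 'k) path \<Rightarrow> 'v \<times> 't"
  assumes "k_graph \<Lambda>"
    and "row_finite_no_sources \<Lambda>"
    and "system_of_maps \<Lambda> T \<sigma>"
    and "intertwining \<Lambda> T \<sigma> \<Phi>"
  shows "\<exists>(E :: ('v, 'm, 1) kgraph) (\<rho> :: 'm \<Rightarrow> 't \<Rightarrow> 't) (\<Psi> :: ('v, 'm, 1) path \<Rightarrow> 'v \<times> 't).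
           k_graph E \<and> row_finite_no_sources E \<and> Obj E = Obj \<Lambda>
         \<and> system_of_maps E T \<rho> \<and> intertwining E T \<rho> \<Psi>
         \<and> attractor E \<Psi> = attractor \<Lambda> \<Phi>"
proof -
  interpret k_graph \<Lambda> by fact
  show ?thesis
    using k_graph_diag_graph[OF assms(1)] row_finite_no_sources_diag_graph[OF assms(2)]
      diag_graph_simps(1)[of \<Lambda>] system_of_maps_diag_graph[OF assms(3)]
      intertwining_diag_graph[OF assms(4)] attractor_diag_graph[of \<Phi>]
    by blast
qed

end
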